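(* Let $1\le L\le r$. In the source condition $x^\dag-x_1=B^pw$, $p\ge0$, if $w\sim\mathcal{N}(0,I_m)$ (standard Gaussian distribution on $\mathbb{R}^m$), then, with $e_1=x_1-x^\dag$ and the expectation taken over $w$, there hold $$\mathbb{E}[\|P_{\mathcal{L}}e_1\|^2]=\sum_{i=1}^L\sigma_i^{4p}\quad\text{and}\quad\mathbb{E}[\|P_{\mathcal{H}}e_1\|^2]=\sum_{i=L+1}^r\sigma_i^{4p}.$$
   Context: Let $A\in\mathbb{R}^{n\times m}$ have rank $r$ and let $n^{-1/2}A=U\Sigma V^t$ be a singular value decomposition with $U\in\mathbb{R}^{n\times n}$, $V=[v_1\ \cdots\ v_m]\in\mathbb{R}^{m\times m}$ orthonormal and $\Sigma=\mathrm{diag}(\sigma_1,\ldots,\sigma_r,0,\ldots,0)\in\mathbb{R}^{n\times m}$ with diagonal entries ordered nonincreasingly. $B=n^{-1}A^tA\in\mathbb{R}^{m\times m}$ is symmetric positive semidefinite, and $B^p$ denotes the usual fractional power (via spectral decomposition). For the truncation level $L$, set $\mathcal{L}=\mathrm{span}\{v_i\}_{i=1}^L$ and $\mathcal{H}=\mathrm{span}\{v_i\}_{i=L+1}^{\min(n,m)}$, with orthogonal projections $P_{\mathcal{L}}$ and $P_{\mathcal{H}}$ onto them. $x_1\in\mathbb{R}^m$ is the initial guess of an iterative method for the linear system $Ax=y^\dag$, and $x^\dag$ is the reference solution, i.e. the solution of $Ax=y^\dag$ minimizing $\|x-x_1\|$, so $e_1$ is the initial error. $\|\cdot\|$ is the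 Euclidean norm. *)

theory Defs
  imports "HOL-Probability.Probability"
begin

definition diag_matrix :: "real ^ 'm \<Rightarrow> real ^ 'm ^ 'm" where
  "diag_matrix d = (\<chi> i j. if i = j then d $ i else 0)"

text \<open>
  The finite types indexing rows and columns carry no order, so the numbering of the coordinates
  is given by enumerations \<open>en\<close> of the rows and \<open>em\<close> of the columns, starting at 1. The \<open>i\<close>-th
  diagonal entry of \<open>S\<close> is \<open>S $ en i $ em i\<close>, and the \<open>i\<close>-th right singular vector is
  \<open>column (em i) V\<close>.
\<close>

definition is_svd ::
  "(nat \<Rightarrow> 'n) \<Rightarrow> (nat \<Rightarrow> 'm) \<Rightarrow> real ^ 'm ^ 'n \<Rightarrow>
   real ^ 'n ^ 'n \<Rightarrow> real ^ 'm ^ 'n \<Rightarrow> real ^ 'm ^ 'm \<Rightarrow> (nat \<Rightarrow> real) \<Rightarrow> bool" where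
  "is_svd en em M U S V \<sigma> \<longleftrightarrow>
     bij_betw en {1..CARD('n)} UNIV \<and> bij_betw em {1..CARD('m)} UNIV \<and>
     orthogonal_matrix U \<and> orthogonal_matrix V \<and>
     M = U ** S ** transpose V \<and>
     (\<forall>i\<in>{1..CARD('n)}. \<forall>j\<in>{1..CARD('m)}.
        S $ en i $ em j = (if i = j \<and> i \<le> rank M then \<sigma> i else 0)) \<and>
     (\<forall>i\<in>{1..rank M}. 0 \<le> \<sigma> i) \<and>
     (\<forall>i j. 1 \<le> i \<longrightarrow> i \<le> j \<longrightarrow> j \<le> rank M \<longrightarrow> \<sigma> j \<le> \<sigma> i)"

text \<open>The case distinction is needed because \<open>0 powr 0 = 0\<close>; it makes the zeroth power of
  every symmetric positive semidefinite matrix the identity.\<close>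

definition nonneg_power :: "real \<Rightarrow> real \<Rightarrow> real" where
  "nonneg_power t p = (if p = 0 then 1 else t powr p)"

text \<open>The description is unique for symmetric \<open>B\<close>, since the result does not depend on the
  chosen orthonormal eigenbasis; it is intended for positive semidefinite \<open>B\<close> and \<open>p \<ge> 0\<close>.\<close>

definition fractional_power :: "real ^ 'm ^ 'm \<Rightarrow> real \<Rightarrow> real ^ 'm ^ 'm" where
  "fractional_power B p =
     (THE C. \<exists>Q d. orthogonal_matrix Q \<and>
        B = Q ** diag_matrix d ** transpose Q \<and>
        C = Q ** diag_matrix (\<chi> i. nonneg_power (d $ i) p) ** transpose Q)"

definition orth_proj :: "'a::euclidean_space set \<Rightarrow> 'a \<Rightarrow> 'a" where
  "orth_proj S x = (THE y. y \<in> S \<and> (\<forall>z\<in>S. orthogonal (x - y) z))"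

definition std_gaussian_density :: "real ^ 'm \<Rightarrow> real" where
  "std_gaussian_density x = exp (- (norm x)\<^sup>2 / 2) / sqrt (2 * pi) ^ CARD('m)"

end

theory Submission
  imports Defs
begin

text \<open>
  The squared norm of a projection of \<open>e1\<close> is the sum of the squared coefficients \<open>v i \<bullet> e1\<close>.
  If \<open>v i\<close> lies in the kernel of \<open>A\<close> (that is, \<open>i > r\<close> or \<open>\<sigma> i = 0\<close>), minimality of \<open>xdag\<close> makes
  the coefficient vanish; for \<open>p = 0\<close> the source condition alone would not give this, as \<open>B\<^sup>0\<close> is the
  identity. Otherwise the coefficient is \<open>-\<sigma> i powr (2 * p) * (v i \<bullet> w)\<close>, and \<open>v i \<bullet> w\<close> has second
  moment \<open>1\<close> because the standard Gaussian density is a product of normal densities.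
\<close>

section \<open>Second moments of the standard Gaussian\<close>

text \<open>Fubini's theorem in coordinates: \<open>lborel\<close> on a Euclidean space is the image
  of the product of one-dimensional copies under the map that assembles a vector from its
  coordinates.\<close>

lemma has_bochner_integral_lborel_prod:
  fixes f :: "'a::euclidean_space \<Rightarrow> real \<Rightarrow> real"
  assumes f: "\<And>b. b \<in> Basis \<Longrightarrow> integrable lborel (f b)"
  shows "has_bochner_integral lborel (\<lambda>x. \<Prod>b\<in>Basis. f b (x \<bullet> b))
           (\<Prod>b\<in>Basis. integral\<^sup>L lborel (f b))"
proof -
  interpret product_sigma_finite "\<lambda>_::'a. lborel :: real measure" ..
  have [measurable]: "f b \<in> borel_measurable borel" if "b \<in> Basis" for b
    using borel_measurable_integrable[OF f[OF that]] by simp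
  have meas: "(\<lambda>x. \<Prod>b\<in>Basis. f b (x \<bullet> b)) \<in> borel_measurable borel"
    by measurable
  have T: "(\<lambda>x. \<Sum>b\<in>Basis. x b *\<^sub>R b) \<in> Pi\<^sub>M Basis (\<lambda>_. lborel) \<rightarrow>\<^sub>M (borel :: 'a measure)"
    by measurable
  have coord: "(\<Prod>b\<in>Basis. f b ((\<Sum>c\<in>Basis. x c *\<^sub>R c) \<bullet> b)) = (\<Prod>b\<in>Basis. f b (x b))" for x
    by (intro prod.cong) simp_all
  show ?thesis
    unfolding has_bochner_integral_iff
    using product_integrable_prod[OF finite_Basis f] product_integral_prod[OF finite_Basis f]
    by (subst (1 2) lborel_eq)
      (simp add: integrable_distr_eq[OF T meas] integral_distr[OF T meas] coord)
qed

lemma std_gaussian_density_prod: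
  fixes x :: "real ^ 'm"
  shows "std_gaussian_density x = (\<Prod>b\<in>Basis. std_normal_density (x \<bullet> b))"
proof -
  have "(norm x)\<^sup>2 = (\<Sum>b\<in>Basis. (x \<bullet> b)\<^sup>2)"
    unfolding power2_norm_eq_inner by (subst euclidean_inner) (simp add: power2_eq_square)
  then have "exp (- (norm x)\<^sup>2 / 2) = (\<Prod>b\<in>Basis. exp (- (x \<bullet> b)\<^sup>2 / 2))"
    by (simp add: exp_sum sum_divide_distrib flip: sum_negf)
  then show ?thesis
    by (simp add: std_gaussian_density_def std_normal_density_def prod_dividef)
qed

lemma std_gaussian_coordinate_moment:
  fixes b c :: "real ^ 'm"
  assumes b: "b \<in> Basis" and c: "c \<in> Basis"
  shows "has_bochner_integral lborel
    (\<lambda>x. std_gaussian_density x * ((x \<bullet> b) * (x \<bullet> c))) (if b = c then 1 else 0)"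
proof -
  \<comment> \<open>The exponent counts how many of \<open>b\<close> and \<open>c\<close> equal
    \<open>k\<close>, so it is 0, 1 or 2, and the integrand splits into one-variable
    factors.\<close>
  define f where "f = (\<lambda>k y. std_normal_density y * y ^ (of_bool (k = b) + of_bool (k = c)))"
  have eq: "(\<Prod>k\<in>Basis. f k (x \<bullet> k)) = std_gaussian_density x * ((x \<bullet> b) * (x \<bullet> c))" for x
  proof -
    have "(\<Prod>k\<in>Basis. (x \<bullet> k) ^ of_bool (k = a)) = x \<bullet> a" if "a \<in> Basis" for a
    proof -
      have "(\<Prod>k\<in>Basis. (x \<bullet> k) ^ of_bool (k = a)) = (\<Prod>k\<in>Basis. if k = a then x \<bullet> k else 1)"
        by (intro prod.cong) auto
      then show ?thesis using that by simp
    qed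
    then show ?thesis
      using b c by (simp add: f_def std_gaussian_density_prod prod.distrib power_add)
  qed
  have int: "integrable lborel (f k)" for k
    unfolding f_def by (rule integrable_std_normal_moment)
  \<comment> \<open>The exponent is 0 or 2 exactly when \<open>k = b\<close> and
    \<open>k = c\<close> have the same truth value, and these two normal moments are both 1.
    Exponent 1 gives the mean, which is 0.\<close>
  have one: "integral\<^sup>L lborel (f k) = (if (k = b) = (k = c) then 1 else 0)" for k
    using integral_std_normal_moment_even[of 0] integral_std_normal_moment_odd[of 0]
      integral_std_normal_moment_even[of 1]
    by (auto simp: f_def numeral_2_eq_2)
  \<comment> \<open>For \<open>b \<noteq> c\<close> the factor at \<open>k = b\<close> is a mean, so
    the product vanishes.\<close>
  have "(\<Prod>k\<in>Basis. integral\<^sup>L lborel (f k)) = (if b = c then 1 else 0)"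
    using b by (auto simp: one intro!: prod_zero)
  then show ?thesis
    using has_bochner_integral_lborel_prod[of f] int by (simp add: eq)
qed

text \<open>Expanding the square over the coordinates leaves only the diagonal terms, since mixed
  moments vanish. This replaces an appeal to rotation invariance.\<close>

lemma std_gaussian_second_moment:
  fixes a :: "real ^ 'm"
  shows "has_bochner_integral lborel (\<lambda>x. std_gaussian_density x * (a \<bullet> x)\<^sup>2) ((norm a)\<^sup>2)"
proof -
  have "has_bochner_integral lborel
     (\<lambda>x. \<Sum>b\<in>Basis. \<Sum>c\<in>Basis. (a \<bullet> b) * (a \<bullet> c) *
        (std_gaussian_density x * ((x \<bullet> b) * (x \<bullet> c))))
     (\<Sum>b\<in>Basis. \<Sum>c\<in>Basis. (a \<bullet> b) * (a \<bullet> c) * (if b = c then 1 else 0))"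
    by (intro has_bochner_integral_sum has_bochner_integral_mult_right
        std_gaussian_coordinate_moment)
  moreover have "(\<Sum>b\<in>Basis. \<Sum>c\<in>Basis. (a \<bullet> b) * (a \<bullet> c) *
        (std_gaussian_density x * ((x \<bullet> b) * (x \<bullet> c)))) = std_gaussian_density x * (a \<bullet> x)\<^sup>2" for x
    unfolding power2_eq_square euclidean_inner[of a x]
    by (simp add: sum_product sum_distrib_left mult_ac)
  moreover have "(\<Sum>b\<in>Basis. \<Sum>c\<in>Basis. (a \<bullet> b) * (a \<bullet> c) * (if b = c then 1 else 0)) = (norm a)\<^sup>2"
    unfolding power2_norm_eq_inner euclidean_inner[of a a]
    by (intro sum.cong refl) (simp add: if_distrib [of "\<lambda>t. _ * t"] cong: if_cong)
  ultimately show ?thesis by simp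
qed

lemma (in prob_space) std_gaussian_second_moment_distributed:
  fixes w :: "'a \<Rightarrow> real ^ 'm"
  assumes w: "distributed M lborel w (\<lambda>x. ennreal (std_gaussian_density x))"
  shows "has_bochner_integral M (\<lambda>\<omega>. (a \<bullet> w \<omega>)\<^sup>2) ((norm a)\<^sup>2)"
proof -
  \<comment> \<open>\<open>ennreal\<close> sends negative reals to 0, so nonnegativity is what
    identifies the density of \<open>w\<close> with the real-valued function.\<close>
  have nn: "0 \<le> std_gaussian_density x" for x :: "real ^ 'm"
    by (simp add: std_gaussian_density_def)
  have meas: "(\<lambda>x. (a \<bullet> x)\<^sup>2) \<in> borel_measurable lborel"
    by measurable
  show ?thesis
    using std_gaussian_second_moment[of a] distributed_integrable[OF w meas nn]
      distributed_integral[OF w meas nn]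
    by (simp add: has_bochner_integral_iff)
qed

section \<open>Diagonal matrices and fractional powers\<close>

lemma diag_matrix_mult_nth [simp]: "(diag_matrix d ** W) $ i $ j = d $ i * W $ i $ j"
  by (simp add: diag_matrix_def matrix_matrix_mult_def if_distrib [of "\<lambda>t. t * _"] cong: if_cong)

lemma mult_diag_matrix_nth [simp]: "(W ** diag_matrix d) $ i $ j = W $ i $ j * d $ j"
  by (simp add: diag_matrix_def matrix_matrix_mult_def if_distrib [of "\<lambda>t. _ * t"] cong: if_cong)

lemma orthogonal_diagonalization_map_unique:
  fixes Q R :: "real ^ 'm ^ 'm"
  assumes Q: "orthogonal_matrix Q" and R: "orthogonal_matrix R"
    and eq: "Q ** diag_matrix d ** transpose Q = R ** diag_matrix e ** transpose R"
  shows "Q ** diag_matrix (\<chi> i. f (d $ i)) ** transpose Q =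
         R ** diag_matrix (\<chi> i. f (e $ i)) ** transpose R"
proof -
  have QQ: "transpose Q ** Q = mat 1" "Q ** transpose Q = mat 1"
    and RR: "transpose R ** R = mat 1" "R ** transpose R = mat 1"
    using Q R by (auto simp: orthogonal_matrix_def)
  \<comment> \<open>The change of basis intertwines the two diagonal matrices, so its nonzero entries
    link equal eigenvalues only and it also intertwines their images under \<open>f\<close>.\<close>
  define W where "W = transpose Q ** R"
  have "diag_matrix d ** W = transpose Q ** (Q ** diag_matrix d ** transpose Q) ** R"
    by (simp add: W_def matrix_mul_assoc QQ)
  also have "\<dots> = transpose Q ** R ** diag_matrix e ** (transpose R ** R)"
    unfolding eq by (simp only: matrix_mul_assoc)
  also have "\<dots> = W ** diag_matrix e"
    by (simp add: RR W_def)
  finally have "d $ i * W $ i $ j = W $ i $ j * e $ j" for i j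
    by (metis diag_matrix_mult_nth mult_diag_matrix_nth)
  then have "f (d $ i) * W $ i $ j = W $ i $ j * f (e $ j)" for i j
    by (metis mult.commute mult_cancel_left)
  then have comm: "diag_matrix (\<chi> i. f (d $ i)) ** W = W ** diag_matrix (\<chi> i. f (e $ i))"
    by (simp add: vec_eq_iff)
  have "Q ** diag_matrix (\<chi> i. f (d $ i)) ** transpose Q =
      Q ** diag_matrix (\<chi> i. f (d $ i)) ** transpose Q ** (R ** transpose R)"
    by (simp add: RR)
  also have "\<dots> = Q ** (diag_matrix (\<chi> i. f (d $ i)) ** W) ** transpose R"
    by (simp only: W_def matrix_mul_assoc)
  also have "\<dots> = (Q ** transpose Q) ** R ** diag_matrix (\<chi> i. f (e $ i)) ** transpose R"
    unfolding comm by (simp only: W_def matrix_mul_assoc)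
  finally show ?thesis by (simp add: QQ)
qed

text \<open>Independence of the diagonalization makes the definite description well defined, so the
  power can be computed in any orthonormal eigenbasis, in particular that of the right singular
  vectors.\<close>

lemma fractional_power_eq:
  assumes "orthogonal_matrix Q" and "B = Q ** diag_matrix d ** transpose Q"
  shows "fractional_power B p =
         Q ** diag_matrix (\<chi> i. nonneg_power (d $ i) p) ** transpose Q"
  unfolding fractional_power_def
proof (rule the_equality)
  show "\<exists>R e. orthogonal_matrix R \<and> B = R ** diag_matrix e ** transpose R \<and>
      Q ** diag_matrix (\<chi> i. nonneg_power (d $ i) p) ** transpose Q =
      R ** diag_matrix (\<chi> i. nonneg_power (e $ i) p) ** transpose R"
    using assms by blast
next
  fix C
  assume "\<exists>R e. orthogonal_matrix R \<and> B = R ** diag_matrix e ** transpose R \<and>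
      C = R ** diag_matrix (\<chi> i. nonneg_power (e $ i) p) ** transpose R"
  then show "C = Q ** diag_matrix (\<chi> i. nonneg_power (d $ i) p) ** transpose Q"
    using orthogonal_diagonalization_map_unique[OF assms(1), where f = "\<lambda>t. nonneg_power t p"]
      assms(2) by metis
qed

lemma inner_matrix_vector_mult: "x \<bullet> (M *v y) = (transpose M *v x) \<bullet> (y :: real ^ _)"
  by (metis dot_lmul_matrix transpose_matrix_vector)

text \<open>The column is an eigenvector of the symmetric matrix: \<open>transpose V\<close> sends
  it to a coordinate vector, on which the diagonal matrix acts as a scalar.\<close>

lemma inner_column_conj_diag:
  fixes V :: "real ^ 'm ^ 'm"
  assumes "orthogonal_matrix V"
  shows "column k V \<bullet> ((V ** diag_matrix f ** transpose V) *v x) = f $ k * (column k V \<bullet> x)"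
proof -
  have "transpose V *v column k V = axis k 1"
    using assms
    by (simp add: orthogonal_matrix_def matrix_vector_mul_assoc flip: matrix_vector_mult_basis)
  then have "column k V \<bullet> ((V ** diag_matrix f ** transpose V) *v x) =
      axis k 1 \<bullet> (diag_matrix f *v (transpose V *v x))"
    by (simp add: inner_matrix_vector_mult flip: matrix_vector_mul_assoc)
  also have "\<dots> = f $ k * (transpose V *v x) $ k"
    by (simp add: inner_axis' matrix_vector_mult_def diag_matrix_def
        if_distrib [of "\<lambda>t. t * _"] cong: if_cong)
  also have "(transpose V *v x) $ k = column k V \<bullet> x"
    by (simp add: matrix_vector_mul_component column_def transpose_def)
  finally show ?thesis .
qed

section \<open>Orthogonal projection onto an orthonormal span\<close>

lemma orth_proj_orthonormal:
  fixes v :: "'i \<Rightarrow> 'a::euclidean_space"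
  assumes I: "finite I"
    and on: "\<And>i j. i \<in> I \<Longrightarrow> j \<in> I \<Longrightarrow> v i \<bullet> v j = (if i = j then 1 else 0)"
  shows "orth_proj (span (v ` I)) x = (\<Sum>i\<in>I. (v i \<bullet> x) *\<^sub>R v i)"
  unfolding orth_proj_def
proof (rule the_equality)
  let ?y = "\<Sum>i\<in>I. (v i \<bullet> x) *\<^sub>R v i"
  have y: "?y \<in> span (v ` I)"
    by (intro span_sum span_scale span_base) auto
  have "orthogonal (x - ?y) (v j)" if "j \<in> I" for j
    using that I
    by (simp add: orthogonal_def inner_diff_left inner_sum_left on inner_commute[of x]
        if_distrib [of "\<lambda>t. _ * t"] cong: if_cong)
  then have orth: "\<forall>z\<in>span (v ` I). orthogonal (x - ?y) z"
    by (auto intro: orthogonal_to_span)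
  show "?y \<in> span (v ` I) \<and> (\<forall>z\<in>span (v ` I). orthogonal (x - ?y) z)"
    using y orth by blast
  fix u assume u: "u \<in> span (v ` I) \<and> (\<forall>z\<in>span (v ` I). orthogonal (x - u) z)"
  then have "u - ?y \<in> span (v ` I)"
    using y by (blast intro: span_diff)
  \<comment> \<open>Both residuals are orthogonal to the difference of the two candidates, which
    lies in the span; subtracting shows that this difference is orthogonal to itself.\<close>
  with u orth have "(x - u) \<bullet> (u - ?y) = 0" "(x - ?y) \<bullet> (u - ?y) = 0"
    by (auto simp: orthogonal_def)
  then have "(u - ?y) \<bullet> (u - ?y) = 0"
    by (simp add: inner_diff_left)
  then show "u = ?y" by simp
qed

lemma norm_orth_proj_orthonormal:
  fixes v :: "'i \<Rightarrow> 'a::euclidean_space"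
  assumes I: "finite I"
    and on: "\<And>i j. i \<in> I \<Longrightarrow> j \<in> I \<Longrightarrow> v i \<bullet> v j = (if i = j then 1 else 0)"
  shows "(norm (orth_proj (span (v ` I)) x))\<^sup>2 = (\<Sum>i\<in>I. (v i \<bullet> x)\<^sup>2)"
proof -
  have "orth_proj (span (v ` I)) x = (\<Sum>i\<in>I. (v i \<bullet> x) *\<^sub>R v i)"
    using assms by (rule orth_proj_orthonormal)
  then show ?thesis
    unfolding power2_norm_eq_inner
    using I by (simp add: inner_sum_left inner_sum_right on power2_eq_square
        if_distrib [of "\<lambda>t. _ * t"] cong: if_cong)
qed

section \<open>Minimum-norm solutions\<close>

text \<open>Moving along a kernel vector preserves the equation, so a nonzero component in that
  direction could be removed to obtain a solution closer to \<open>x1\<close>.\<close>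

lemma min_norm_solution_orthogonal_kernel:
  fixes A :: "real ^ 'm ^ 'n"
  assumes min: "is_arg_min (\<lambda>x. norm (x - x1)) (\<lambda>x. A *v x = y) x" and k: "A *v k = 0"
  shows "k \<bullet> (x - x1) = 0"
proof (rule ccontr)
  let ?u = "x - x1"
  assume ne: "k \<bullet> ?u \<noteq> 0"
  then have k0: "k \<bullet> k > 0" by auto
  \<comment> \<open>This \<open>t\<close> minimizes the quadratic
    \<open>t \<mapsto> (norm (?u - t *\<^sub>R k))\<^sup>2\<close>; the decrease is
    \<open>(k \<bullet> ?u)\<^sup>2 / (k \<bullet> k)\<close>.\<close>
  define t where "t = (k \<bullet> ?u) / (k \<bullet> k)"
  have "A *v (x - t *\<^sub>R k) = y"
    using min k by (simp add: is_arg_min_def matrix_vector_mult_diff_distrib matrix_vector_mult_scaleR)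
  then have "\<not> norm (x - t *\<^sub>R k - x1) < norm ?u"
    using min by (auto simp: is_arg_min_def)
  then have "norm ?u \<le> norm (?u - t *\<^sub>R k)"
    by (simp add: algebra_simps)
  then have "(norm ?u)\<^sup>2 \<le> (norm (?u - t *\<^sub>R k))\<^sup>2"
    by (simp add: power_mono)
  also have "\<dots> = (norm ?u)\<^sup>2 - 2 * t * (k \<bullet> ?u) + t * t * (k \<bullet> k)"
    unfolding power2_norm_eq_inner by (simp add: inner_diff_left inner_diff_right inner_commute algebra_simps)
  also have "\<dots> = (norm ?u)\<^sup>2 - (k \<bullet> ?u)\<^sup>2 / (k \<bullet> k)"
    using k0 by (simp add: t_def power2_eq_square field_simps)
  finally have "(k \<bullet> ?u)\<^sup>2 / (k \<bullet> k) \<le> 0" by simp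
  with ne k0 show False
    by (metis not_le zero_less_divide_iff zero_less_power2)
qed

section \<open>Consequences of the singular value decomposition\<close>

text \<open>Scaling leaves the range unchanged. This links \<open>r\<close>, the rank of
  \<open>A\<close>, to the rank of the normalized matrix that is decomposed.\<close>

lemma rank_scaleR:
  fixes A :: "real ^ 'm ^ 'n"
  assumes "c \<noteq> 0"
  shows "rank (c *\<^sub>R A) = rank A"
proof -
  have "range ((*v) (c *\<^sub>R A)) = range ((*v) A)"
  proof safe
    fix x
    show "(c *\<^sub>R A) *v x \<in> range ((*v) A)"
      by (metis matrix_vector_mult_scaleR rangeI scaleR_matrix_vector_assoc)
    have "A *v x = (c *\<^sub>R A) *v (inverse c *\<^sub>R x)"
      using assms by (simp add: matrix_vector_mult_scaleR flip: scaleR_matrix_vector_assoc)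
    then show "A *v x \<in> range ((*v) (c *\<^sub>R A))" by blast
  qed
  then show ?thesis by (simp add: rank_dim_range)
qed

lemma is_svd_entry:
  fixes M :: "real ^ 'm ^ 'n"
  assumes svd: "is_svd en em M U S V \<sigma>" and l: "l \<in> {1..CARD('n)}" and j: "j \<in> {1..CARD('m)}"
  shows "S $ en l $ em j = (if l = j \<and> l \<le> rank M then \<sigma> l else 0)"
  using assms unfolding is_svd_def by blast

lemma is_svd_gram_nth:
  fixes M :: "real ^ 'm ^ 'n"
  assumes svd: "is_svd en em M U S V \<sigma>" and i: "i \<in> {1..CARD('m)}" and j: "j \<in> {1..CARD('m)}"
  shows "(transpose S ** S) $ em i $ em j = (if i = j \<and> i \<le> rank M then (\<sigma> i)\<^sup>2 else 0)"
proof -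
  have en: "bij_betw en {1..CARD('n)} UNIV"
    using svd by (simp add: is_svd_def)
  have "rank M \<le> CARD('n)"
    using rank_bound[of M] by simp
  have "(transpose S ** S) $ em i $ em j = (\<Sum>k\<in>UNIV. S $ k $ em i * S $ k $ em j)"
    by (simp add: matrix_matrix_mult_def transpose_def)
  also have "\<dots> = (\<Sum>l\<in>{1..CARD('n)}. S $ en l $ em i * S $ en l $ em j)"
    by (rule sum.reindex_bij_betw[OF en, symmetric])
  also have "\<dots> = (\<Sum>l\<in>{1..CARD('n)}. if l = i then if i = j \<and> i \<le> rank M then (\<sigma> i)\<^sup>2 else 0 else 0)"
    using i j by (intro sum.cong) (auto simp: is_svd_entry[OF svd] power2_eq_square)
  \<comment> \<open>If \<open>i \<le> rank M\<close>, row number \<open>i\<close> exists because the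
    rank is at most the number of rows; otherwise every term is 0, even when \<open>i\<close>
    exceeds that number.\<close>
  also have "\<dots> = (if i = j \<and> i \<le> rank M then (\<sigma> i)\<^sup>2 else 0)"
    using i \<open>rank M \<le> CARD('n)\<close> by auto
  finally show ?thesis .
qed

text \<open>In the Gram matrix the factor \<open>U\<close> cancels, leaving
  \<open>transpose S ** S\<close> conjugated by \<open>V\<close>; its diagonal serves as
  \<open>d\<close>.\<close>

lemma is_svd_gram_diagonal:
  fixes M :: "real ^ 'm ^ 'n"
  assumes svd: "is_svd en em M U S V \<sigma>"
  obtains d where "transpose M ** M = V ** diag_matrix d ** transpose V"
    and "\<And>i. 1 \<le> i \<Longrightarrow> i \<le> rank M \<Longrightarrow> d $ em i = (\<sigma> i)\<^sup>2"
proof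
  let ?d = "\<chi> k. (transpose S ** S) $ k $ k"
  have em: "bij_betw em {1..CARD('m)} UNIV" and U: "transpose U ** U = mat 1"
    and M: "M = U ** S ** transpose V"
    using svd by (auto simp: is_svd_def orthogonal_matrix_def)
  have "(transpose S ** S) $ a $ b = diag_matrix ?d $ a $ b" for a b
  proof -
    obtain i j where ij: "i \<in> {1..CARD('m)}" "a = em i" "j \<in> {1..CARD('m)}" "b = em j"
      using em unfolding bij_betw_def by blast
    then show ?thesis
      using is_svd_gram_nth[OF svd ij(1,3)] by (auto simp: diag_matrix_def)
  qed
  then have D: "transpose S ** S = diag_matrix ?d"
    unfolding vec_eq_iff by blast
  have "transpose M ** M = V ** transpose S ** (transpose U ** U) ** S ** transpose V"
    by (simp only: M matrix_transpose_mul transpose_transpose matrix_mul_assoc)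
  also have "\<dots> = V ** (transpose S ** S) ** transpose V"
    by (simp only: U matrix_mul_rid matrix_mul_assoc)
  finally show "transpose M ** M = V ** diag_matrix ?d ** transpose V"
    unfolding D[symmetric] .
  fix i assume "1 \<le> i" "i \<le> rank M"
  then show "?d $ em i = (\<sigma> i)\<^sup>2"
    using is_svd_gram_nth[OF svd, of i i] rank_bound[of M] by simp
qed

text \<open>From \<open>M ** V = U ** S\<close>, the image of the singular vector is
  \<open>U\<close> applied to the matching column of \<open>S\<close>, and that column is zero in
  either case of \<open>z\<close>.\<close>

lemma is_svd_kernel:
  fixes M :: "real ^ 'm ^ 'n"
  assumes svd: "is_svd en em M U S V \<sigma>" and i: "i \<in> {1..CARD('m)}"
    and z: "rank M < i \<or> \<sigma> i = 0"
  shows "M *v column (em i) V = 0"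
proof -
  have en: "bij_betw en {1..CARD('n)} UNIV" and V: "transpose V ** V = mat 1"
    and M: "M = U ** S ** transpose V"
    using svd by (auto simp: is_svd_def orthogonal_matrix_def)
  have "S $ k $ em i = 0" for k
  proof -
    obtain l where "l \<in> {1..CARD('n)}" "k = en l"
      using en unfolding bij_betw_def by blast
    then show ?thesis
      using is_svd_entry[OF svd _ i] z by auto
  qed
  then have S: "column (em i) S = 0"
    by (simp add: column_def vec_eq_iff)
  have "M ** V = U ** S"
    by (simp add: M V flip: matrix_mul_assoc)
  then have "M *v column (em i) V = U *v column (em i) S"
    by (metis matrix_vector_mul_assoc matrix_vector_mult_basis)
  then show ?thesis by (simp add: S)
qed

lemma is_svd_orthonormal:
  fixes M :: "real ^ 'm ^ 'n"
  assumes svd: "is_svd en em M U S V \<sigma>" and i: "i \<in> {1..CARD('m)}" and j: "j \<in> {1..CARD('m)}"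
  shows "column (em i) V \<bullet> column (em j) V = (if i = j then 1 else 0)"
proof -
  have em: "inj_on em {1..CARD('m)}" and V: "orthogonal_matrix V"
    using svd by (auto simp: is_svd_def bij_betw_def)
  have "(em i = em j) = (i = j)"
    using em i j by (auto dest: inj_onD)
  then show ?thesis
    using V by (auto simp: orthogonal_matrix_orthonormal_columns pairwise_def orthogonal_def
        norm_eq_1)
qed

section \<open>Expected squared projections of the initial error\<close>

theorem proposition5p1:
  fixes A :: "real ^ 'm ^ 'n"
    and U :: "real ^ 'n ^ 'n" and S :: "real ^ 'm ^ 'n" and V :: "real ^ 'm ^ 'm"
    and en :: "nat \<Rightarrow> 'n" and em :: "nat \<Rightarrow> 'm"
    and \<sigma> :: "nat \<Rightarrow> real" and v :: "nat \<Rightarrow> real ^ 'm"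
    and B :: "real ^ 'm ^ 'm"
    and r L :: nat and p :: real
    and P :: "'w measure" and w :: "'w \<Rightarrow> real ^ 'm"
    and x1 :: "real ^ 'm" and xdag :: "'w \<Rightarrow> real ^ 'm" and ydag :: "'w \<Rightarrow> real ^ 'n"
    and e1 :: "'w \<Rightarrow> real ^ 'm"
    and Lsp Hsp :: "(real ^ 'm) set"
  assumes rank: "r = rank A"
    and svd: "is_svd en em ((1 / sqrt (real CARD('n))) *\<^sub>R A) U S V \<sigma>"
    and v: "\<And>i. v i = column (em i) V"
    and B: "B = (1 / real CARD('n)) *\<^sub>R (transpose A ** A)"
    and L: "1 \<le> L" "L \<le> r"
    and Lsp: "Lsp = span (v ` {1..L})"
    and Hsp: "Hsp = span (v ` {L + 1..min CARD('n) CARD('m)})"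
    and p: "0 \<le> p"
    and prob: "prob_space P"
    and w: "distributed P lborel w (\<lambda>x. ennreal (std_gaussian_density x))"
    and ref: "\<And>\<omega>. \<omega> \<in> space P \<Longrightarrow>
                is_arg_min (\<lambda>x. norm (x - x1)) (\<lambda>x. A *v x = ydag \<omega>) (xdag \<omega>)"
    and source: "\<And>\<omega>. \<omega> \<in> space P \<Longrightarrow> xdag \<omega> - x1 = fractional_power B p *v w \<omega>"
    and e1: "\<And>\<omega>. e1 \<omega> = x1 - xdag \<omega>"
  shows "integrable P (\<lambda>\<omega>. (norm (orth_proj Lsp (e1 \<omega>)))\<^sup>2) \<and>
         prob_space.expectation P (\<lambda>\<omega>. (norm (orth_proj Lsp (e1 \<omega>)))\<^sup>2)
           = (\<Sum>i = 1..L. \<sigma> i powr (4 * p)) \<and>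
         integrable P (\<lambda>\<omega>. (norm (orth_proj Hsp (e1 \<omega>)))\<^sup>2) \<and>
         prob_space.expectation P (\<lambda>\<omega>. (norm (orth_proj Hsp (e1 \<omega>)))\<^sup>2)
           = (\<Sum>i = L + 1..r. \<sigma> i powr (4 * p))"
proof -
  interpret prob_space P by (rule prob)
  define M where "M = (1 / sqrt (real CARD('n))) *\<^sub>R A"
  note svd = svd[folded M_def]
  have rM: "rank M = r"
    by (simp add: M_def rank rank_scaleR)
  have r_le: "r \<le> min CARD('n) CARD('m)"
    using rank_bound[of A] by (simp add: rank)
  \<comment> \<open>The factor \<open>1 / sqrt n\<close> enters the Gram matrix twice and produces
    the \<open>1 / n\<close> of \<open>B\<close>.\<close>
  have BM: "B = transpose M ** M"
    by (simp add: B M_def transpose_scalar matrix_scalar_ac flip: scalar_matrix_assoc)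
  have V: "orthogonal_matrix V"
    using svd by (simp add: is_svd_def)
  obtain d where d: "B = V ** diag_matrix d ** transpose V"
    and d_\<sigma>: "\<And>i. 1 \<le> i \<Longrightarrow> i \<le> r \<Longrightarrow> d $ em i = (\<sigma> i)\<^sup>2"
    using is_svd_gram_diagonal[OF svd] unfolding BM rM by metis
  have on: "v i \<bullet> v j = (if i = j then 1 else 0)" if "i \<in> {1..CARD('m)}" "j \<in> {1..CARD('m)}" for i j
    using is_svd_orthonormal[OF svd that] by (simp add: v)
  have zero: "v i \<bullet> e1 \<omega> = 0"
    if "i \<in> {1..CARD('m)}" "r < i \<or> \<sigma> i = 0" "\<omega> \<in> space P" for i \<omega>
  proof -
    have "M *v v i = 0"
      using is_svd_kernel[OF svd that(1)] that(2) by (simp add: v rM)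
    then have "A *v v i = 0"
      by (simp add: M_def flip: scaleR_matrix_vector_assoc)
    from min_norm_solution_orthogonal_kernel[OF ref[OF that(3)] this] show ?thesis
      by (simp add: e1 inner_diff_right)
  qed
  have coeff: "v i \<bullet> e1 \<omega> = - (nonneg_power ((\<sigma> i)\<^sup>2) p * (v i \<bullet> w \<omega>))"
    if "1 \<le> i" "i \<le> r" "\<omega> \<in> space P" for i \<omega>
  proof -
    have "v i \<bullet> (xdag \<omega> - x1) = nonneg_power ((\<sigma> i)\<^sup>2) p * (v i \<bullet> w \<omega>)"
      unfolding source[OF that(3)] fractional_power_eq[OF V d] v inner_column_conj_diag[OF V]
      using d_\<sigma> that by simp
    then show ?thesis by (simp add: e1 inner_diff_right)
  qed
  have moment: "has_bochner_integral P (\<lambda>\<omega>. (v i \<bullet> e1 \<omega>)\<^sup>2) (if i \<le> r then \<sigma> i powr (4 * p) else 0)"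
    if i: "i \<in> {1..CARD('m)}" for i
  proof (cases "r < i \<or> \<sigma> i = 0")
    \<comment> \<open>If \<open>\<sigma> i = 0\<close> with \<open>i \<le> r\<close>, the claimed
      value is still 0, even for \<open>p = 0\<close>, since \<open>0 powr 0 = 0\<close>. Treating
      this case here avoids deriving positivity of \<open>\<sigma> i\<close> from the rank.\<close>
    case True
    then have "has_bochner_integral P (\<lambda>\<omega>. (v i \<bullet> e1 \<omega>)\<^sup>2) 0 \<longleftrightarrow>
        has_bochner_integral P (\<lambda>\<omega>. 0 :: real) 0"
      using zero[OF i] by (intro has_bochner_integral_cong) auto
    with True show ?thesis by auto
  next
    case False
    then have ir: "1 \<le> i" "i \<le> r" using i by auto
    have \<sigma>: "\<sigma> i > 0"
    proof -
      have "\<forall>i\<in>{1..r}. 0 \<le> \<sigma> i"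
        using svd unfolding is_svd_def rM by blast
      then show ?thesis
        using False ir by (auto simp: less_le)
    qed
    have "norm (v i) = 1"
      using on[OF i i] by (simp add: norm_eq_1)
    then have "has_bochner_integral P (\<lambda>\<omega>. (nonneg_power ((\<sigma> i)\<^sup>2) p)\<^sup>2 * (v i \<bullet> w \<omega>)\<^sup>2)
        ((nonneg_power ((\<sigma> i)\<^sup>2) p)\<^sup>2)"
      using has_bochner_integral_mult_right[OF std_gaussian_second_moment_distributed[OF w, of "v i"],
          of "(nonneg_power ((\<sigma> i)\<^sup>2) p)\<^sup>2"] by simp
    moreover have "(nonneg_power ((\<sigma> i)\<^sup>2) p)\<^sup>2 = \<sigma> i powr (4 * p)"
    proof -
      \<comment> \<open>Positivity of \<open>\<sigma> i\<close> reconciles the convention for the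
        zeroth power with \<open>powr\<close>, as then \<open>\<sigma> i powr 0 = 1\<close>.\<close>
      have "nonneg_power ((\<sigma> i)\<^sup>2) p = \<sigma> i powr (2 * p)"
        using \<sigma> by (simp add: nonneg_power_def powr_powr flip: powr_numeral)
      then show ?thesis
        using \<sigma> by (simp add: power2_eq_square flip: powr_add)
    qed
    moreover have "has_bochner_integral P (\<lambda>\<omega>. (v i \<bullet> e1 \<omega>)\<^sup>2) t \<longleftrightarrow>
        has_bochner_integral P (\<lambda>\<omega>. (nonneg_power ((\<sigma> i)\<^sup>2) p)\<^sup>2 * (v i \<bullet> w \<omega>)\<^sup>2) t" for t
      using coeff[OF ir] by (intro has_bochner_integral_cong) (auto simp: power_mult_distrib)
    ultimately show ?thesis using ir by simp
  qed
  \<comment> \<open>Linearity of the expectation over the squared coefficients suffices;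
    independence of the coefficients does not enter.\<close>
  have proj: "has_bochner_integral P (\<lambda>\<omega>. (norm (orth_proj (span (v ` I)) (e1 \<omega>)))\<^sup>2)
      (\<Sum>i\<in>I. if i \<le> r then \<sigma> i powr (4 * p) else 0)" if I: "I \<subseteq> {1..CARD('m)}" for I
  proof -
    have "(norm (orth_proj (span (v ` I)) x))\<^sup>2 = (\<Sum>i\<in>I. (v i \<bullet> x)\<^sup>2)" for x
      using I by (intro norm_orth_proj_orthonormal on) (auto intro: finite_subset)
    moreover have "has_bochner_integral P (\<lambda>\<omega>. \<Sum>i\<in>I. (v i \<bullet> e1 \<omega>)\<^sup>2)
        (\<Sum>i\<in>I. if i \<le> r then \<sigma> i powr (4 * p) else 0)"
      using I by (intro has_bochner_integral_sum moment) auto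
    ultimately show ?thesis by simp
  qed
  have "(\<Sum>i = 1..L. if i \<le> r then \<sigma> i powr (4 * p) else 0) = (\<Sum>i = 1..L. \<sigma> i powr (4 * p))"
    using L by (intro sum.cong) auto
  \<comment> \<open>The high-frequency space may contain singular vectors beyond the rank; their
    terms are 0, and \<open>r_le\<close> ensures that every index up to \<open>r\<close> is
    included.\<close>
  moreover have "(\<Sum>i = L + 1..min CARD('n) CARD('m). if i \<le> r then \<sigma> i powr (4 * p) else 0) =
      (\<Sum>i = L + 1..r. \<sigma> i powr (4 * p))"
    using r_le by (intro sum.mono_neutral_cong_right) auto
  ultimately show ?thesis
    using proj[of "{1..L}"] proj[of "{L + 1..min CARD('n) CARD('m)}"] L r_le
    by (simp add: has_bochner_integral_iff Lsp Hsp)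
qed

end
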